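(* Let $\Phi\in\overline\nabla_2$. Then there exists a positive constant $C_\Phi$ such that, for all measurable functions $f$ on $\mathbb{R}^n$, $$\sup_{t\in(0,\infty)}\Phi(t)\,m(Mf,t)\le\sup_{t\in(0,\infty)}\Phi(t)\,m(C_\Phi f,t).$$
   Context: For a measurable function $f$ on $\mathbb{R}^n$ and $t\ge0$, $m(f,t)=|\{x\in\mathbb{R}^n:|f(x)|>t\}|$, where $|\cdot|$ is Lebesgue measure. $M$ is the Hardy-Littlewood maximal operator, $Mf(x)=\sup_{B\ni x}\frac1{|B|}\int_B|f(y)|\,dy$, the supremum being over all open balls $B$ containing $x$. The convention $0\cdot\infty=0$ is used in products $\Phi(t)\,m(\cdot,t)$. "Increasing" means nondecreasing. For an increasing $\Phi:[0,\infty]\to[0,\infty]$ let $a(\Phi)=\sup\{t\ge0:\Phi(t)=0\}$ and $b(\Phi)=\inf\{t\ge0:\Phi(t)=\infty\}$, with $\sup\emptyset=0$, $\inf\emptyset=\infty$. $\overline{\varPhi}$ is the set of all increasing $\Phi:[0,\infty]\to[0,\infty]$ such that: $0\le a(\Phi)<\infty$ and $0<b(\Phi)\le\infty$; $\lim_{t\to+0}\Phi(t)=\Phi(0)=0$; $\Phi$ is left continuous on $[0,b(\Phi))$; if $b(\Phi)=\infty$ then $\lim_{t\to\infty}\Phi(t)=\Phi(\infty)=\infty$; if $b(\Phi)<\infty$ then $\lim_{t\to b(\Phi)-0}\Phi(t)=\Phi(b(\Phi))$ $(\le\infty)$. $\overline\nabla_2$ is the set of all $\Phi\in\overline{\varPhi}$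 for which there is a constant $k>1$ with $\Phi(t)\le\frac1{2k}\Phi(kt)$ for all $t>0$. *)

theory Defs
  imports "HOL-Analysis.Analysis"
begin

text \<open>\<open>m(g,t)\<close> for a function that is already nonnegative and extended-valued, so that it
  applies both to \<open>\<bar>f\<bar>\<close> and to \<open>Mf\<close>, which may take the value \<open>\<infinity>\<close>.\<close>

definition dist_fun :: "('a::euclidean_space \<Rightarrow> ennreal) \<Rightarrow> ennreal \<Rightarrow> ennreal" where
  "dist_fun g t = emeasure lebesgue {x. t < g x}"

text \<open>Supremum over all open balls containing \<open>x\<close>, not only those centred at \<open>x\<close>
  (\<open>x \<in> ball c r\<close> forces \<open>r > 0\<close>).\<close>

definition hl_maximal ::
    "('a::euclidean_space \<Rightarrow> 'b::real_normed_vector) \<Rightarrow> 'a \<Rightarrow> ennreal" where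
  "hl_maximal f x =
     (SUP B\<in>{B. \<exists>c r. B = ball c r \<and> x \<in> B}.
        (\<integral>\<^sup>+ y\<in>B. ennreal (norm (f y)) \<partial>lebesgue) / emeasure lebesgue B)"

text \<open>In \<^typ>\<open>ennreal\<close>, \<open>Sup {} = 0\<close> and \<open>Inf {} = \<infinity>\<close>.\<close>

definition a_of :: "(ennreal \<Rightarrow> ennreal) \<Rightarrow> ennreal" where
  "a_of \<Phi> = Sup {t. \<Phi> t = 0}"

definition b_of :: "(ennreal \<Rightarrow> ennreal) \<Rightarrow> ennreal" where
  "b_of \<Phi> = Inf {t. \<Phi> t = \<infinity>}"

text \<open>The filter \<open>at_left \<infinity>\<close> expresses \<open>t \<rightarrow> \<infinity>\<close> through finite \<open>t\<close>;
  \<open>at_left 0\<close> is trivial in \<^typ>\<open>ennreal\<close>, so left continuity at \<open>0\<close> is no condition.\<close>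

definition Phi_bar :: "(ennreal \<Rightarrow> ennreal) set" where
  "Phi_bar = {\<Phi>. mono \<Phi> \<and>
     a_of \<Phi> < \<infinity> \<and> 0 < b_of \<Phi> \<and>
     (\<Phi> \<longlongrightarrow> 0) (at_right 0) \<and> \<Phi> 0 = 0 \<and>
     (\<forall>t<b_of \<Phi>. continuous (at_left t) \<Phi>) \<and>
     (b_of \<Phi> = \<infinity> \<longrightarrow> (\<Phi> \<longlongrightarrow> \<infinity>) (at_left \<infinity>) \<and> \<Phi> \<infinity> = \<infinity>) \<and>
     (b_of \<Phi> < \<infinity> \<longrightarrow> (\<Phi> \<longlongrightarrow> \<Phi> (b_of \<Phi>)) (at_left (b_of \<Phi>)))}"

definition nabla2_bar :: "(ennreal \<Rightarrow> ennreal) set" where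
  "nabla2_bar = {\<Phi> \<in> Phi_bar. \<exists>k::real. k > 1 \<and>
     (\<forall>t\<in>{0<..<\<infinity>}. \<Phi> t \<le> ennreal (1 / (2 * k)) * \<Phi> (ennreal k * t))}"

end

theory Submission
  imports Defs
begin

text \<open>Split \<open>f\<close> at height \<open>t\<close>: the Vitali covering lemma gives
  \<open>m(Mf, 2t) \<le> (5\<^sup>n / t) \<integral>\<^bsub>{\<bar>f\<bar> > t}\<^esub> \<bar>f\<bar>\<close>, and cutting the integral into the
  layers \<open>k\<^sup>j t < \<bar>f\<bar> \<le> k\<^sup>j\<^sup>+\<^sup>1 t\<close> bounds it by \<open>\<Sum>\<^sub>j k\<^sup>j\<^sup>+\<^sup>1 t m(f, k\<^sup>j t)\<close>. Iterating
  the condition \<open>\<nabla>\<^sub>2\<close> gives \<open>(2k)\<^sup>j \<Phi>(Ct) \<le> \<Phi>(C k\<^sup>j t)\<close>, so after multiplication by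
  \<open>\<Phi>(Ct)\<close> the series is dominated by a geometric one with ratio \<open>1/2\<close>. The resulting
  constant \<open>5\<^sup>n 2k\<close> is absorbed by taking \<open>C = 2 k\<^sup>N\<close> with \<open>(2k)\<^sup>N\<close> at least that large.\<close>

section \<open>Weak-type estimate on a superlevel set\<close>

text \<open>On a ball \<open>B\<close> where \<open>norm f\<close> averages more than
  \<open>2 * t\<close>, the values up to \<open>t\<close> contribute at most \<open>t\<close> times
  the measure of \<open>B\<close>, so the values above \<open>t\<close> must supply at least as much
  again.\<close>

lemma hl_maximal_greaterE:
  fixes f :: "'a::euclidean_space \<Rightarrow> 'b::real_normed_vector"
  assumes f: "f \<in> borel_measurable lebesgue" and "0 < t"
    and x: "ennreal (2 * t) < hl_maximal f x"
  obtains c r where "0 < r" "x \<in> ball c r"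
    "ennreal t * emeasure lebesgue (ball c r)
      \<le> (\<integral>\<^sup>+ y\<in>ball c r. ennreal (norm (f y)) * indicator {y. t < norm (f y)} y \<partial>lebesgue)"
proof -
  have [measurable]: "f \<in> borel_measurable lebesgue" by (rule f)
  obtain c r where xB: "x \<in> ball c r" and
    B: "ennreal (2 * t) < (\<integral>\<^sup>+ y\<in>ball c r. ennreal (norm (f y)) \<partial>lebesgue)
            / emeasure lebesgue (ball c r)"
    using x unfolding hl_maximal_def less_SUP_iff by auto
  have "0 < r"
    using xB by (metis empty_iff ball_eq_empty not_le)
  define g where "g y = ennreal (norm (f y)) * indicator {y. t < norm (f y)} y" for y
  have g[measurable]: "g \<in> borel_measurable lebesgue"
    unfolding g_def by measurable
  define b where "b = unit_ball_vol DIM('a) * r ^ DIM('a)"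
  have "0 < b" using \<open>0 < r\<close> by (simp add: b_def)
  have eB: "emeasure lebesgue (ball c r) = ennreal b"
    using \<open>0 < r\<close> by (simp add: emeasure_ball b_def)
  have Bsets[measurable]: "ball c r \<in> sets lebesgue" by simp
  have "ennreal t * ennreal b + ennreal t * ennreal b = ennreal (2 * t) * ennreal b"
    using \<open>0 < t\<close> \<open>0 < b\<close> by (simp add: ennreal_mult[symmetric] ennreal_plus[symmetric] del: ennreal_plus)
  also have "\<dots> \<le> ((\<integral>\<^sup>+ y\<in>ball c r. ennreal (norm (f y)) \<partial>lebesgue) / ennreal b) * ennreal b"
    using B by (intro mult_right_mono) (auto simp: eB less_imp_le)
  also have "\<dots> = (\<integral>\<^sup>+ y\<in>ball c r. ennreal (norm (f y)) \<partial>lebesgue)"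
    using \<open>0 < b\<close> by (simp add: ennreal_divide_times)
  also have "\<dots> \<le> (\<integral>\<^sup>+ y. ennreal t * indicator (ball c r) y + g y * indicator (ball c r) y \<partial>lebesgue)"
    by (intro nn_integral_mono) (auto simp: g_def split: split_indicator intro: ennreal_leI)
  also have "\<dots> = (\<integral>\<^sup>+ y. ennreal t * indicator (ball c r) y \<partial>lebesgue)
                + (\<integral>\<^sup>+ y. g y * indicator (ball c r) y \<partial>lebesgue)"
    by (intro nn_integral_add) measurable
  also have "(\<integral>\<^sup>+ y. ennreal t * indicator (ball c r) y \<partial>lebesgue) = ennreal t * ennreal b"
    using eB Bsets by (simp only: nn_integral_cmult_indicator)
  \<comment> \<open>Cancelling one copy of \<open>ennreal t * ennreal b\<close> is legitimate
    because it is finite.\<close>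
  finally have "ennreal t * ennreal b \<le> (\<integral>\<^sup>+ y. g y * indicator (ball c r) y \<partial>lebesgue)"
    by (simp add: ennreal_mult_eq_top_iff)
  with \<open>0 < r\<close> xB show ?thesis
    by (intro that[of r c]) (simp_all add: eB g_def)
qed

text \<open>The set integrals are values of the measure \<open>density M g\<close>, which is
  countably additive on disjoint sets. The sum is an integral over \<open>count_space C\<close>
  because the Vitali lemma yields a countable index set without an enumeration.\<close>

lemma sum_nn_set_integral_le:
  assumes "countable C" "disjoint_family_on B C" "\<And>i. i \<in> C \<Longrightarrow> B i \<in> sets M"
    and g: "g \<in> borel_measurable M"
  shows "(\<integral>\<^sup>+ i. (\<integral>\<^sup>+ y\<in>B i. g y \<partial>M) \<partial>count_space C) \<le> (\<integral>\<^sup>+ y. g y \<partial>M)"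
proof -
  have "(\<integral>\<^sup>+ i. (\<integral>\<^sup>+ y\<in>B i. g y \<partial>M) \<partial>count_space C)
      = (\<integral>\<^sup>+ i. emeasure (density M g) (B i) \<partial>count_space C)"
    using assms by (intro nn_integral_cong) (simp add: emeasure_density)
  also have "\<dots> = emeasure (density M g) (\<Union>i\<in>C. B i)"
    using assms by (intro emeasure_UN_countable[symmetric]) auto
  also have "\<dots> \<le> emeasure (density M g) (space M)"
    using emeasure_space[of "density M g"] by simp
  also have "\<dots> = (\<integral>\<^sup>+ y. g y \<partial>M)"
    using g by (simp add: emeasure_density cong: nn_integral_cong)
  finally show ?thesis .
qed

text \<open>The indicator of the union is at most the sum of the indicators; integrate and exchange
  sum and integral.\<close>

lemma emeasure_UN_countable_le:
  assumes [measurable]: "\<And>i. i \<in> I \<Longrightarrow> X i \<in> sets M" and I: "countable I"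
  shows "emeasure M (\<Union>i\<in>I. X i) \<le> (\<integral>\<^sup>+ i. emeasure M (X i) \<partial>count_space I)"
proof -
  have le: "indicator (\<Union>i\<in>I. X i) x \<le> (\<integral>\<^sup>+ i. indicator (X i) x \<partial>count_space I)" for x
  proof (cases "x \<in> (\<Union>i\<in>I. X i)")
    case True
    then obtain j where "j \<in> I" "x \<in> X j" by blast
    then show ?thesis
      using nn_integral_ge_point[of j I "\<lambda>i. indicator (X i) x"]
      by (auto simp: indicator_def)
  qed simp
  have "emeasure M (\<Union>i\<in>I. X i) = (\<integral>\<^sup>+ x. indicator (\<Union>i\<in>I. X i) x \<partial>M)"
    using assms by (intro nn_integral_indicator[symmetric] sets.countable_UN') auto
  also have "\<dots> \<le> (\<integral>\<^sup>+ x. \<integral>\<^sup>+ i. indicator (X i) x \<partial>count_space I \<partial>M)"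
    by (intro nn_integral_mono le)
  also have "\<dots> = (\<integral>\<^sup>+ i. \<integral>\<^sup>+ x. indicator (X i) x \<partial>M \<partial>count_space I)"
    using I by (intro nn_integral_count_space_nn_integral) auto
  also have "\<dots> = (\<integral>\<^sup>+ i. emeasure M (X i) \<partial>count_space I)"
    by (intro nn_integral_cong) simp
  finally show ?thesis .
qed

lemma hl_maximal_weak_type:
  fixes f :: "'a::euclidean_space \<Rightarrow> 'b::real_normed_vector"
  assumes f: "f \<in> borel_measurable lebesgue" and "0 < t"
  shows "emeasure lebesgue {x. ennreal (2 * t) < hl_maximal f x}
    \<le> ennreal (5 ^ DIM('a) / t) * (\<integral>\<^sup>+ y\<in>{y. t < norm (f y)}. ennreal (norm (f y)) \<partial>lebesgue)"
    (is "emeasure _ ?E \<le> _ * ?I")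
\<comment> \<open>An infinite integral makes the right side infinite; a finite one bounds the radii,
  as the Vitali lemma requires.\<close>
proof (cases "?I = \<infinity>")
  case True
  then show ?thesis
    using \<open>0 < t\<close> by (simp add: ennreal_mult_top)
next
  case False
  have [measurable]: "f \<in> borel_measurable lebesgue" by (rule f)
  define g where "g y = ennreal (norm (f y)) * indicator {y. t < norm (f y)} y" for y
  have g[measurable]: "g \<in> borel_measurable lebesgue"
    unfolding g_def by measurable
  have Ig: "?I = (\<integral>\<^sup>+ y. g y \<partial>lebesgue)" by (simp add: g_def)
  define J where "J = enn2real ?I"
  have J: "?I = ennreal J" "0 \<le> J"
    using False by (auto simp: J_def less_top)
  let ?b = "\<lambda>r. unit_ball_vol DIM('a) * r ^ DIM('a)"
  have "\<forall>x\<in>?E. \<exists>c r. 0 < r \<and> x \<in> ball c r \<and>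
      ennreal t * emeasure lebesgue (ball c r) \<le> (\<integral>\<^sup>+ y\<in>ball c r. g y \<partial>lebesgue)"
    unfolding g_def using hl_maximal_greaterE[OF f \<open>0 < t\<close>] by blast
  then obtain a r where ar: "\<And>x. x \<in> ?E \<Longrightarrow> 0 < r x \<and> x \<in> ball (a x) (r x) \<and>
      ennreal t * emeasure lebesgue (ball (a x) (r x)) \<le> (\<integral>\<^sup>+ y\<in>ball (a x) (r x). g y \<partial>lebesgue)"
    by metis
  \<comment> \<open>The selection inequality bounds \<open>r x ^ DIM('a)\<close> by the second
    argument of \<open>max\<close>. This bounds \<open>r x\<close> itself only if
    \<open>r x > 1\<close>, hence the 1.\<close>
  define R where "R = max 1 (J / (t * unit_ball_vol DIM('a)))"
  have rR: "0 < r x \<and> r x \<le> R" if "x \<in> ?E" for x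
  proof -
    have r: "0 < r x" using ar that by blast
    have "ennreal (t * ?b (r x)) = ennreal t * emeasure lebesgue (ball (a x) (r x))"
      using r \<open>0 < t\<close> by (simp add: emeasure_ball ennreal_mult)
    also have "\<dots> \<le> (\<integral>\<^sup>+ y\<in>ball (a x) (r x). g y \<partial>lebesgue)"
      using ar that by blast
    also have "\<dots> \<le> ennreal J"
      unfolding J(1)[symmetric] Ig by (intro nn_integral_mono) (auto split: split_indicator)
    finally have *: "t * ?b (r x) \<le> J"
      using J(2) by (simp add: ennreal_le_iff)
    have v: "0 < unit_ball_vol DIM('a)" by simp
    have "r x \<le> R"
    proof (cases "r x \<le> 1")
      case False
      then have "r x \<le> r x ^ DIM('a)"
        by (intro self_le_power) auto
      also have "\<dots> \<le> J / (t * unit_ball_vol DIM('a))"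
        using * v \<open>0 < t\<close> by (simp add: field_simps)
      finally show ?thesis by (simp add: R_def)
    qed (simp add: R_def)
    with r show ?thesis by simp
  qed
  have "?E \<subseteq> (\<Union>x\<in>?E. ball (a x) (r x))"
    using ar by blast
  from Vitali_covering_lemma_balls[OF this rR]
  obtain C where C: "countable C" "C \<subseteq> ?E"
     "pairwise (\<lambda>i j. disjnt (ball (a i) (r i)) (ball (a j) (r j))) C"
     "?E \<subseteq> (\<Union>i\<in>C. ball (a i) (5 * r i))"
    by blast
  \<comment> \<open>Monotonicity rests on measurability of the larger set, which is open.\<close>
  have "emeasure lebesgue ?E \<le> emeasure lebesgue (\<Union>i\<in>C. ball (a i) (5 * r i))"
    using C(4) by (rule emeasure_mono) (intro sets_completionI_sets, simp add: borel_open open_UN)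
  also have "\<dots> \<le> (\<integral>\<^sup>+ i. emeasure lebesgue (ball (a i) (5 * r i)) \<partial>count_space C)"
    using C(1) by (intro emeasure_UN_countable_le) auto
  also have "\<dots> \<le> (\<integral>\<^sup>+ i. ennreal (5 ^ DIM('a) / t) * (\<integral>\<^sup>+ y\<in>ball (a i) (r i). g y \<partial>lebesgue) \<partial>count_space C)"
  proof (rule nn_integral_mono)
    fix i assume "i \<in> space (count_space C)"
    then have i: "i \<in> ?E" using C(2) by auto
    \<comment> \<open>Dilation by 5 multiplies the measure by \<open>5 ^ DIM('a)\<close>; the factor
      \<open>t\<close> is inserted to match the selection inequality.\<close>
    have "emeasure lebesgue (ball (a i) (5 * r i)) = ennreal (5 ^ DIM('a) / t) * (ennreal t * emeasure lebesgue (ball (a i) (r i)))"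
      using ar[OF i] \<open>0 < t\<close>
      by (simp add: emeasure_ball ennreal_mult[symmetric] power_mult_distrib field_simps)
    also have "\<dots> \<le> ennreal (5 ^ DIM('a) / t) * (\<integral>\<^sup>+ y\<in>ball (a i) (r i). g y \<partial>lebesgue)"
      using ar[OF i] by (intro mult_left_mono) auto
    finally show "emeasure lebesgue (ball (a i) (5 * r i)) \<le> \<dots>" .
  qed
  also have "\<dots> = ennreal (5 ^ DIM('a) / t) * (\<integral>\<^sup>+ i. (\<integral>\<^sup>+ y\<in>ball (a i) (r i). g y \<partial>lebesgue) \<partial>count_space C)"
    by (intro nn_integral_cmult) simp
  also have "\<dots> \<le> ennreal (5 ^ DIM('a) / t) * (\<integral>\<^sup>+ y. g y \<partial>lebesgue)"
    using C(1,3) by (intro mult_left_mono sum_nn_set_integral_le)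
       (auto simp: disjoint_family_on_def pairwise_def disjnt_def)
  finally show ?thesis unfolding Ig .
qed

section \<open>Geometric layers\<close>

text \<open>A single term suffices: the one for the layer with \<open>k ^ j * t < u\<close> and
  \<open>u \<le> k ^ Suc j * t\<close>.\<close>

lemma ennreal_le_suminf_layers:
  assumes "1 < k" "0 < t" "t < u"
  shows "ennreal u \<le> (\<Sum>j. ennreal (k ^ Suc j * t) * indicator {v. k ^ j * t < v} u)"
proof -
  obtain n where "u / t < k ^ n"
    using real_arch_pow[OF \<open>1 < k\<close>] by blast
  then have ex: "\<exists>n. u \<le> k ^ n * t"
    using \<open>0 < t\<close> by (auto simp: field_simps intro!: exI[of _ n])
  \<comment> \<open>Since \<open>t < u\<close>, the least exponent \<open>m\<close> is positive, and
    minimality places \<open>u\<close> above the level of its predecessor \<open>j\<close>.\<close>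
  define m where "m = (LEAST n. u \<le> k ^ n * t)"
  have m: "u \<le> k ^ m * t"
    unfolding m_def using ex by (rule LeastI_ex)
  have "m \<noteq> 0"
    using m \<open>t < u\<close> by (intro notI) simp
  then obtain j where j: "m = Suc j" using not0_implies_Suc by blast
  then have "k ^ j * t < u"
    using not_less_Least[of j "\<lambda>n. u \<le> k ^ n * t"] by (simp add: m_def[symmetric])
  with m j have "ennreal u \<le> ennreal (k ^ Suc j * t) * indicator {v. k ^ j * t < v} u"
    by (auto intro: ennreal_leI)
  also have "\<dots> \<le> (\<Sum>j. ennreal (k ^ Suc j * t) * indicator {v. k ^ j * t < v} u)"
    using sum_le_suminf[where f = "\<lambda>j. ennreal (k ^ Suc j * t) * indicator {v. k ^ j * t < v} u"
      and I = "{j}", OF summableI]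
    by (simp del: sum_mult_indicator)
  finally show ?thesis .
qed

lemma nn_integral_superlevel_le_suminf:
  assumes f: "f \<in> borel_measurable M" and "1 < k" "0 < t"
  shows "(\<integral>\<^sup>+ y\<in>{y. t < norm (f y)}. ennreal (norm (f y)) \<partial>M)
    \<le> (\<Sum>j. ennreal (k ^ Suc j * t) * emeasure M {y\<in>space M. k ^ j * t < norm (f y)})"
proof -
  have [measurable]: "f \<in> borel_measurable M" by (rule f)
  have "(\<integral>\<^sup>+ y\<in>{y. t < norm (f y)}. ennreal (norm (f y)) \<partial>M)
    \<le> (\<integral>\<^sup>+ y. (\<Sum>j. ennreal (k ^ Suc j * t) * indicator {y\<in>space M. k ^ j * t < norm (f y)} y) \<partial>M)"
  proof (rule nn_integral_mono)
    fix y assume y: "y \<in> space M"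
    show "ennreal (norm (f y)) * indicator {y. t < norm (f y)} y
        \<le> (\<Sum>j. ennreal (k ^ Suc j * t) * indicator {y\<in>space M. k ^ j * t < norm (f y)} y)"
      using ennreal_le_suminf_layers[OF assms(2,3), of "norm (f y)"] y
      by (cases "t < norm (f y)") (auto simp: indicator_def)
  qed
  also have "\<dots> = (\<Sum>j. \<integral>\<^sup>+ y. ennreal (k ^ Suc j * t) * indicator {y\<in>space M. k ^ j * t < norm (f y)} y \<partial>M)"
    by (intro nn_integral_suminf) measurable
  also have "\<dots> = (\<Sum>j. ennreal (k ^ Suc j * t) * emeasure M {y\<in>space M. k ^ j * t < norm (f y)})"
    by (intro suminf_cong nn_integral_cmult_indicator) measurable
  finally show ?thesis .
qed

section \<open>Growth of \<open>\<Phi>\<close> and the geometric series\<close>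

text \<open>While the argument grows by \<open>k ^ j\<close>, the value grows by
  \<open>(2 * k) ^ j\<close>; the surplus \<open>2 ^ j\<close> is what makes the layer series
  converge.\<close>

lemma nabla2_barE:
  assumes "\<Phi> \<in> nabla2_bar"
  obtains k :: real where "1 < k"
    "\<And>t j. 0 < t \<Longrightarrow> ennreal ((2 * k) ^ j) * \<Phi> (ennreal t) \<le> \<Phi> (ennreal (k ^ j * t))"
proof -
  obtain k :: real where k: "1 < k" and
    *: "\<And>t. t \<in> {0<..<\<infinity>} \<Longrightarrow> \<Phi> t \<le> ennreal (1 / (2 * k)) * \<Phi> (ennreal k * t)"
    using assms unfolding nabla2_bar_def by auto
  have step: "ennreal (2 * k) * \<Phi> (ennreal t) \<le> \<Phi> (ennreal (k * t))" if "0 < t" for t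
  proof -
    have "ennreal (2 * k) * \<Phi> (ennreal t)
        \<le> ennreal (2 * k) * (ennreal (1 / (2 * k)) * \<Phi> (ennreal k * ennreal t))"
      using that by (intro mult_left_mono *) auto
    also have "\<dots> = ennreal (2 * k * (1 / (2 * k))) * \<Phi> (ennreal (k * t))"
      using k that by (subst ennreal_mult) (auto simp: ennreal_mult mult.assoc)
    finally show ?thesis using k by simp
  qed
  have "ennreal ((2 * k) ^ j) * \<Phi> (ennreal t) \<le> \<Phi> (ennreal (k ^ j * t))" if "0 < t" for t j
  proof (induction j)
    case (Suc j)
    have "ennreal ((2 * k) ^ Suc j) * \<Phi> (ennreal t)
        = ennreal (2 * k) * (ennreal ((2 * k) ^ j) * \<Phi> (ennreal t))"
      using k by (simp only: power_Suc) (subst ennreal_mult, auto simp: mult.assoc)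
    also have "\<dots> \<le> ennreal (2 * k) * \<Phi> (ennreal (k ^ j * t))"
      by (intro mult_left_mono Suc) simp
    also have "\<dots> \<le> \<Phi> (ennreal (k ^ Suc j * t))"
      using step[of "k ^ j * t"] k that by (simp add: mult.assoc)
    finally show ?case .
  qed simp
  with k show ?thesis by (rule that)
qed

text \<open>The real coefficients are summed first and \<open>S\<close> is factored out, so
  \<open>S\<close> may be \<infinity>.\<close>

lemma suminf_ennreal_geometric_half:
  fixes S :: ennreal
  assumes "0 \<le> c"
  shows "(\<Sum>j. ennreal (c * (1/2) ^ j) * S) = ennreal (2 * c) * S"
proof -
  have "(\<lambda>j. c * (1/2) ^ j) sums (c * (1 / (1 - 1/2)))"
    by (intro sums_mult geometric_sums) simp
  then have "(\<Sum>j. ennreal (c * (1/2) ^ j)) = ennreal (c * 2)"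
    using assms by (intro suminf_ennreal_eq) auto
  then show ?thesis by (simp add: ennreal_suminf_multc mult.commute)
qed

section \<open>Combining the estimates\<close>

theorem theorem3p2:
  fixes \<Phi> :: "ennreal \<Rightarrow> ennreal"
  assumes "\<Phi> \<in> nabla2_bar"
  shows "\<exists>C::real. C > 0 \<and>
    (\<forall>f :: real ^ 'n \<Rightarrow> complex. f \<in> borel_measurable lebesgue \<longrightarrow>
      (SUP t\<in>{0<..<\<infinity>}. \<Phi> t * dist_fun (hl_maximal f) t)
      \<le> (SUP t\<in>{0<..<\<infinity>}. \<Phi> t * dist_fun (\<lambda>x. ennreal (norm (C *\<^sub>R f x))) t))"
proof -
  obtain k :: real where k: "1 < k" and
    nabla: "\<And>t j. 0 < t \<Longrightarrow> ennreal ((2 * k) ^ j) * \<Phi> (ennreal t) \<le> \<Phi> (ennreal (k ^ j * t))"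
    using nabla2_barE[OF assms] by blast
  define d where "d = DIM(real ^ 'n)"
  \<comment> \<open>\<open>5 ^ d\<close> comes from the covering, \<open>k\<close> from the upper
    edge of each layer and 2 from the geometric sum.\<close>
  define A where "A = 5 ^ d * (2 * k)"
  have "0 < A" using k by (simp add: A_def)
  obtain N where N: "A < (2 * k) ^ N"
    using real_arch_pow[of "2 * k" A] k by auto
  \<comment> \<open>The weak-type bound is at level \<open>2 * t\<close>, and
    \<open>C * t = k ^ N * (2 * t)\<close>, so \<open>N\<close> growth steps lead from
    \<open>\<Phi> (2 * t)\<close> to \<open>\<Phi> (C * t)\<close>.\<close>
  define C where "C = 2 * k ^ N"
  have "0 < C" using k by (simp add: C_def)
  have "(SUP t\<in>{0<..<\<infinity>}. \<Phi> t * dist_fun (hl_maximal f) t)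
      \<le> (SUP t\<in>{0<..<\<infinity>}. \<Phi> t * dist_fun (\<lambda>x. ennreal (norm (C *\<^sub>R f x))) t)"
    (is "_ \<le> ?S")
    if f: "f \<in> borel_measurable lebesgue" for f :: "real ^ 'n \<Rightarrow> complex"
  proof (rule SUP_least)
    fix \<tau> :: ennreal assume "\<tau> \<in> {0<..<\<infinity>}"
    then obtain t where t: "\<tau> = ennreal (2 * t)" "0 < t"
      by (cases \<tau>) (auto intro: that[of "enn2real \<tau> / 2"])
    let ?\<mu> = "\<lambda>s. emeasure lebesgue {y. s < norm (f y)}"
    \<comment> \<open>Scaling \<open>f\<close> by \<open>C\<close> turns level \<open>s\<close> into
      level \<open>C * s\<close>, so each such product is one of the terms of
      \<open>?S\<close>.\<close>
    have S: "\<Phi> (ennreal (C * s)) * ?\<mu> s \<le> ?S" if "0 < s" for s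
    proof -
      have "{y. s < norm (f y)} = {y. ennreal (C * s) < ennreal (norm (C *\<^sub>R f y))}"
        using \<open>0 < C\<close> that by (auto simp: ennreal_less_iff)
      then have "\<Phi> (ennreal (C * s)) * ?\<mu> s
          = \<Phi> (ennreal (C * s)) * dist_fun (\<lambda>x. ennreal (norm (C *\<^sub>R f x))) (ennreal (C * s))"
        by (simp add: dist_fun_def)
      also have "\<dots> \<le> ?S"
        using \<open>0 < C\<close> that by (intro SUP_upper) auto
      finally show ?thesis .
    qed
    let ?\<phi> = "\<Phi> (ennreal (C * t))"
    have layer: "?\<phi> * (ennreal (k ^ Suc j * t) * ?\<mu> (k ^ j * t)) \<le> ennreal (k * t * (1/2) ^ j) * ?S" for j
    proof -
      \<comment> \<open>The weight is split so that \<open>\<Phi>\<close> absorbs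
        \<open>(2 * k) ^ j\<close> and the summable factor \<open>(1/2) ^ j\<close> remains.\<close>
      have "k ^ Suc j * t = k * t * (1/2) ^ j * (2 * k) ^ j"
        using k by (simp add: power_mult_distrib power_divide)
      then have "?\<phi> * (ennreal (k ^ Suc j * t) * ?\<mu> (k ^ j * t))
          = ennreal (k * t * (1/2) ^ j) * (ennreal ((2 * k) ^ j) * ?\<phi> * ?\<mu> (k ^ j * t))"
        using k t by (simp only:) (subst ennreal_mult, auto simp: mult_ac)
      also have "\<dots> \<le> ennreal (k * t * (1/2) ^ j) * (\<Phi> (ennreal (C * (k ^ j * t))) * ?\<mu> (k ^ j * t))"
        using nabla[of "C * t" j] \<open>0 < C\<close> t
        by (intro mult_left_mono mult_right_mono) (auto simp: mult_ac)
      also have "\<dots> \<le> ennreal (k * t * (1/2) ^ j) * ?S"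
        using k t by (intro mult_left_mono S) auto
      finally show ?thesis .
    qed
    have \<phi>: "?\<phi> * dist_fun (hl_maximal f) \<tau> \<le> ennreal A * ?S"
    proof -
      have "?\<phi> * dist_fun (hl_maximal f) \<tau>
          \<le> ?\<phi> * (ennreal (5 ^ d / t) * (\<integral>\<^sup>+ y\<in>{y. t < norm (f y)}. ennreal (norm (f y)) \<partial>lebesgue))"
        unfolding dist_fun_def t d_def by (intro mult_left_mono hl_maximal_weak_type f t) simp
      also have "\<dots> \<le> ?\<phi> * (ennreal (5 ^ d / t) * (\<Sum>j. ennreal (k ^ Suc j * t) * ?\<mu> (k ^ j * t)))"
        using nn_integral_superlevel_le_suminf[OF f k t(2)]
        by (intro mult_left_mono) auto
      also have "\<dots> = ennreal (5 ^ d / t) * (\<Sum>j. ?\<phi> * (ennreal (k ^ Suc j * t) * ?\<mu> (k ^ j * t)))"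
        by (simp only: ennreal_suminf_cmult mult.left_commute)
      also have "\<dots> \<le> ennreal (5 ^ d / t) * (\<Sum>j. ennreal (k * t * (1/2) ^ j) * ?S)"
        by (intro mult_left_mono suminf_le layer) auto
      also have "\<dots> = ennreal (5 ^ d / t) * (ennreal (2 * (k * t)) * ?S)"
        using k t by (subst suminf_ennreal_geometric_half) auto
      also have "\<dots> = ennreal A * ?S"
        using k t by (simp add: A_def mult.assoc[symmetric] ennreal_mult[symmetric])
      finally show ?thesis .
    qed
    have "ennreal A * (\<Phi> \<tau> * dist_fun (hl_maximal f) \<tau>)
        \<le> ennreal ((2 * k) ^ N) * \<Phi> \<tau> * dist_fun (hl_maximal f) \<tau>"
      unfolding mult.assoc using N by (intro mult_right_mono ennreal_leI) auto
    also have "\<dots> \<le> ?\<phi> * dist_fun (hl_maximal f) \<tau>"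
      using nabla[of "2 * t" N] t by (intro mult_right_mono) (auto simp: C_def mult_ac)
    also note \<phi>
    \<comment> \<open>\<open>A\<close> is positive and finite, so it cancels even when
      \<open>?S\<close> is \<infinity>.\<close>
    finally show "\<Phi> \<tau> * dist_fun (hl_maximal f) \<tau> \<le> ?S"
      using \<open>0 < A\<close> by (simp add: ennreal_mult_le_mult_iff)
  qed
  with \<open>0 < C\<close> show ?thesis by blast
qed

end
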